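(* Let $F=\langle W,R,S\rangle$ be an $\mathbf{IL}$-frame (Veltman frame). Then $F\models\mathsf R$ if and only if for all $x,y,z,u,v\in W$: if $xRy$, $yRz$, $zS_xu$ and $uRv$, then $zS_yv$. Here $\mathsf R$ is the schema $(A\rhd B)\rightarrow\bigl(\neg(A\rhd\neg C)\rhd(B\wedge\Box C)\bigr)$.
   Context: Modal formulas are built from $\bot$ and countably many propositional variables using $\rightarrow$, the unary modality $\Box$ and the binary modality $\rhd$; other boolean connectives are defined as usual and $\Diamond A:=\neg\Box\neg A$. An $\mathbf{IL}$-frame is a triple $\langle W,R,S\rangle$ with $W$ a non-empty countable set, $R$ a binary relation on $W$, and $S=(S_x)_{x\in W}$ a family of binary relations on $W$ such that: (1) $R$ is conversely well-founded (every non-empty subset of $W$ has an $R$-maximal element); (2) $R$ is transitive; (3) $yS_xz$ implies $xRy$ and $xRz$; (4) $xRy$ implies $yS_xy$; (5) $xRy$ and $yRz$ imply $yS_xz$; (6) $uS_xv$ and $vS_xw$ imply $uS_xw$. An $\mathbf{IL}$-model is an $\mathbf{IL}$-frame with a relation $\Vdash$ between worlds and propositional variables, extended to all formulas by: $\Vdash$ commutes with $\bot$ and $\rightarrow$; $w\Vdash\Box A$ iff $v\Vdash A$ for all $v$ with $wRv$; $w\Vdash A\rhd B$ iff for all $u$ with $wRu$ and $u\Vdash A$ there is $v$ with $uS_wv$ and $v\Vdash B$. $F\models\mathsf R$ means that every instance of the schema $\mathsf R$ is true at every world of every model based on $F$. *)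

theory Defs
  imports "HOL-Library.Countable_Set"
begin

datatype fm =
    Bot
  | Var nat
  | Imp fm fm  (infixr "\<^bold>\<rightarrow>" 55)
  | Box fm  ("\<^bold>\<box>_" [80] 80)
  | Rhd fm fm  (infix "\<rhd>" 60)

abbreviation Neg :: "fm \<Rightarrow> fm"  ("\<^bold>\<not>_" [80] 80)
  where "\<^bold>\<not>A \<equiv> A \<^bold>\<rightarrow> Bot"

abbreviation Conj :: "fm \<Rightarrow> fm \<Rightarrow> fm"  (infixr "\<^bold>\<and>" 65)
  where "A \<^bold>\<and> B \<equiv> \<^bold>\<not>(A \<^bold>\<rightarrow> \<^bold>\<not>B)"

(* y S_x z is written (y, z) \<in> S x. The family S is indexed by W, so the values of S
   outside W are irrelevant and left unconstrained. *)
locale IL_frame =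
  fixes W :: "'w set" and R :: "('w \<times> 'w) set" and S :: "'w \<Rightarrow> ('w \<times> 'w) set"
  assumes nonempty: "W \<noteq> {}"
    and countable: "countable W"
    and R_on: "R \<subseteq> W \<times> W"
    and S_on: "x \<in> W \<Longrightarrow> S x \<subseteq> W \<times> W"
    and conversely_wf: "X \<subseteq> W \<Longrightarrow> X \<noteq> {} \<Longrightarrow> \<exists>m\<in>X. \<forall>y\<in>X. (m, y) \<notin> R"
    and R_trans: "trans R"
    and S_R: "x \<in> W \<Longrightarrow> (y, z) \<in> S x \<Longrightarrow> (x, y) \<in> R \<and> (x, z) \<in> R"
    and S_refl: "x \<in> W \<Longrightarrow> (x, y) \<in> R \<Longrightarrow> (y, y) \<in> S x"
    and R_S: "x \<in> W \<Longrightarrow> (x, y) \<in> R \<Longrightarrow> (y, z) \<in> R \<Longrightarrow> (y, z) \<in> S x"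
    and S_trans: "x \<in> W \<Longrightarrow> trans (S x)"

primrec forces ::
  "('w \<times> 'w) set \<Rightarrow> ('w \<Rightarrow> ('w \<times> 'w) set) \<Rightarrow> ('w \<Rightarrow> nat \<Rightarrow> bool) \<Rightarrow> 'w \<Rightarrow> fm \<Rightarrow> bool"
where
  "forces R S V w Bot \<longleftrightarrow> False"
| "forces R S V w (Var p) \<longleftrightarrow> V w p"
| "forces R S V w (A \<^bold>\<rightarrow> B) \<longleftrightarrow> (forces R S V w A \<longrightarrow> forces R S V w B)"
| "forces R S V w (\<^bold>\<box>A) \<longleftrightarrow> (\<forall>v. (w, v) \<in> R \<longrightarrow> forces R S V v A)"
| "forces R S V w (A \<rhd> B) \<longleftrightarrow>
    (\<forall>u. (w, u) \<in> R \<and> forces R S V u A \<longrightarrow> (\<exists>v. (u, v) \<in> S w \<and> forces R S V v B))"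

(* A schema is identified with the set of its instances. *)
definition frame_validates ::
  "'w set \<Rightarrow> ('w \<times> 'w) set \<Rightarrow> ('w \<Rightarrow> ('w \<times> 'w) set) \<Rightarrow> fm set \<Rightarrow> bool"
where
  "frame_validates W R S \<Phi> \<longleftrightarrow> (\<forall>V. \<forall>A\<in>\<Phi>. \<forall>w\<in>W. forces R S V w A)"

definition schema_R :: "fm set" where
  "schema_R = {(A \<rhd> B) \<^bold>\<rightarrow> (\<^bold>\<not>(A \<rhd> \<^bold>\<not>C) \<rhd> (B \<^bold>\<and> \<^bold>\<box>C)) | A B C. True}"

end

theory Submission
  imports Defs
begin

theorem lemma4p1:
  fixes W :: "'w set" and R :: "('w \<times> 'w) set" and S :: "'w \<Rightarrow> ('w \<times> 'w) set"
  assumes "IL_frame W R S"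
  shows "frame_validates W R S schema_R \<longleftrightarrow>
    (\<forall>x\<in>W. \<forall>y\<in>W. \<forall>z\<in>W. \<forall>u\<in>W. \<forall>v\<in>W.
      (x, y) \<in> R \<and> (y, z) \<in> R \<and> (z, u) \<in> S x \<and> (u, v) \<in> R \<longrightarrow> (z, v) \<in> S y)"
    (is "?valid \<longleftrightarrow> ?cond")
proof
  assume valid: ?valid
  show ?cond
  proof (intro ballI impI, elim conjE)
    fix x y z u v
    assume "x \<in> W" and xy: "(x, y) \<in> R" and yz: "(y, z) \<in> R"
      and zu: "(z, u) \<in> S x" and uv: "(u, v) \<in> R"
    define V where "V w n \<longleftrightarrow>
      (if n = 0 then w = z else if n = 1 then w = u else (z, w) \<in> S y)" for w and n :: nat
    have "(Var 0 \<rhd> Var 1) \<^bold>\<rightarrow> (\<^bold>\<not>(Var 0 \<rhd> \<^bold>\<not>Var 2) \<rhd> (Var 1 \<^bold>\<and> \<^bold>\<box>Var 2)) \<in> schema_R"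
      unfolding schema_R_def by blast
    with valid \<open>x \<in> W\<close> have inst: "forces R S V x
        ((Var 0 \<rhd> Var 1) \<^bold>\<rightarrow> (\<^bold>\<not>(Var 0 \<rhd> \<^bold>\<not>Var 2) \<rhd> (Var 1 \<^bold>\<and> \<^bold>\<box>Var 2)))"
      unfolding frame_validates_def by blast
    have "forces R S V x (Var 0 \<rhd> Var 1)"
      using zu by (auto simp: V_def)
    moreover have "forces R S V y (\<^bold>\<not>(Var 0 \<rhd> \<^bold>\<not>Var 2))"
      using yz by (auto simp: V_def)
    ultimately obtain t where "forces R S V t (Var 1 \<^bold>\<and> \<^bold>\<box>Var 2)"
      using inst xy by (meson forces.simps(3,5))
    then have "forces R S V u (\<^bold>\<box>Var 2)"
      by (simp add: V_def)
    with uv show "(z, v) \<in> S y"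
      by (simp add: V_def)
  qed
next
  interpret IL_frame W R S by fact
  assume cond: ?cond
  have "forces R S V x ((A \<rhd> B) \<^bold>\<rightarrow> (\<^bold>\<not>(A \<rhd> \<^bold>\<not>C) \<rhd> (B \<^bold>\<and> \<^bold>\<box>C)))"
    if "x \<in> W" for V x A B C
  proof -
    have "\<exists>u. (y, u) \<in> S x \<and> forces R S V u (B \<^bold>\<and> \<^bold>\<box>C)"
      if AB: "forces R S V x (A \<rhd> B)" and xy: "(x, y) \<in> R"
        and notAC: "forces R S V y (\<^bold>\<not>(A \<rhd> \<^bold>\<not>C))" for y
    proof -
      from notAC obtain z where yz: "(y, z) \<in> R" and A: "forces R S V z A"
        and C: "\<And>v. (z, v) \<in> S y \<Longrightarrow> forces R S V v C"
        by auto
      have "(x, z) \<in> R"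
        using R_trans xy yz by (rule transD)
      with AB A obtain u where zu: "(z, u) \<in> S x" and B: "forces R S V u B"
        by auto
      have "forces R S V v C" if uv: "(u, v) \<in> R" for v
      proof -
        have "y \<in> W" "z \<in> W" "u \<in> W" "v \<in> W"
          using R_on yz uv by auto
        with cond \<open>x \<in> W\<close> xy yz zu uv have "(z, v) \<in> S y"
          by blast
        then show ?thesis
          by (rule C)
      qed
      moreover have "(y, u) \<in> S x"
        using S_trans R_S \<open>x \<in> W\<close> xy yz zu by (meson transD)
      ultimately show ?thesis
        using B by auto
    qed
    then show ?thesis
      by simp
  qed
  then show ?valid
    unfolding frame_validates_def schema_R_def by blast
qed

end
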